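(* Let $X_n$, $n\ge1$, be a stationary sequence of centered real random variables that is L-weakly dependent with coefficients $\gamma_k$, $k\geq 1$. Let $S_n=X_1+\cdots+X_n$ and assume that $\frac1n\mathbb{E}S_n^2\to\sigma^2$ as $n\to\infty$ for some $\sigma^2\in(0,\infty)$. Assume that $v(n)=\sum_{k=n}^\infty\gamma_k$ satisfies $v(n)=O(\rho^n)$ for some $\rho\in(0,1)$, and that there exist $\tau>3$ and $U>0$ such that $$\sup_{|t|\le\tau}\mathbb{E}e^{t|X_1|}\le U .$$ Then $\frac1nS_n\to0$ almost surely with convergence rate $\frac{(\log n)^{3/2}}{n^{1/2-\delta}}$, where $\delta>0$ is arbitrarily small; that is, for every $\delta>0$, almost surely $\frac1n S_n=O\left(\frac{(\log n)^{3/2}}{n^{1/2-\delta}}\right)$ as $n\to\infty$.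
   Context: Stationary means strictly stationary. L-weak dependence: real random variables $X_n$, $n\ge1$, are L-weakly dependent with nonnegative coefficients $\gamma_k$, $k\ge1$, if $\sum_{k\ge1}\gamma_k<\infty$ and for all disjoint finite subsets $I,J\subset\{1,2,\ldots\}$ and all real valued Lipschitz functions $f:\mathbb{R}^I\to\mathbb{R}$, $g:\mathbb{R}^J\to\mathbb{R}$, the covariance below is well defined and $$|\mathrm{Cov}(f(X_i,i\in I),g(X_j,j\in J))|\le \|f\|_L\|g\|_L\sum_{i\in I}\sum_{j\in J}\gamma_{|j-i|},$$ where $\|f\|_L=\sup_{x\neq y}\frac{|f(x)-f(y)|}{|x-y|}$ and $|x-y|=\sum_i|x_i-y_i|$ is the $\ell^1$ distance. *)

theory Defs
  imports "HOL-Probability.Probability" "HOL-Library.Landau_Symbols"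
begin

text \<open>
  Points of the coordinate space over a finite index set \<open>I\<close> are the extensional functions in
  \<open>I \<rightarrow>\<^sub>E UNIV\<close>. All sequences \<open>X\<close> and \<open>\<gamma>\<close> below are indexed from 1 on; their value at index 0
  plays no role.
\<close>

definition l1_dist :: "nat set \<Rightarrow> (nat \<Rightarrow> real) \<Rightarrow> (nat \<Rightarrow> real) \<Rightarrow> real" where
  "l1_dist I x y = (\<Sum>i\<in>I. \<bar>x i - y i\<bar>)"

definition l1_lipschitz :: "nat set \<Rightarrow> ((nat \<Rightarrow> real) \<Rightarrow> real) \<Rightarrow> bool" where
  "l1_lipschitz I f \<longleftrightarrow>
     (\<exists>C. \<forall>x\<in>I \<rightarrow>\<^sub>E UNIV. \<forall>y\<in>I \<rightarrow>\<^sub>E UNIV. \<bar>f x - f y\<bar> \<le> C * l1_dist I x y)"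

text \<open>
  The \<open>0\<close> is inserted only to obtain the value 0 when \<open>I\<close> is empty, where the supremum runs over
  the empty set. The supremum is meaningful only if \<open>l1_lipschitz I f\<close> holds.
\<close>

definition lip_norm :: "nat set \<Rightarrow> ((nat \<Rightarrow> real) \<Rightarrow> real) \<Rightarrow> real" where
  "lip_norm I f =
     Sup (insert 0 {\<bar>f x - f y\<bar> / l1_dist I x y | x y.
            x \<in> I \<rightarrow>\<^sub>E UNIV \<and> y \<in> I \<rightarrow>\<^sub>E UNIV \<and> x \<noteq> y})"

definition cov_defined :: "'a measure \<Rightarrow> ('a \<Rightarrow> real) \<Rightarrow> ('a \<Rightarrow> real) \<Rightarrow> bool" where
  "cov_defined M Y Z \<longleftrightarrow>
     integrable M Y \<and> integrable M Z \<and> integrable M (\<lambda>\<omega>. Y \<omega> * Z \<omega>)"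

definition cov :: "'a measure \<Rightarrow> ('a \<Rightarrow> real) \<Rightarrow> ('a \<Rightarrow> real) \<Rightarrow> real" where
  "cov M Y Z =
     (LINT \<omega>|M. Y \<omega> * Z \<omega>) - (LINT \<omega>|M. Y \<omega>) * (LINT \<omega>|M. Z \<omega>)"

definition L_weakly_dependent ::
    "'a measure \<Rightarrow> (nat \<Rightarrow> 'a \<Rightarrow> real) \<Rightarrow> (nat \<Rightarrow> real) \<Rightarrow> bool" where
  "L_weakly_dependent M X \<gamma> \<longleftrightarrow>
     (\<forall>k\<ge>1. 0 \<le> \<gamma> k) \<and> summable (\<lambda>k. \<gamma> (k + 1)) \<and>
     (\<forall>I J f g. finite I \<and> finite J \<and> I \<subseteq> {1..} \<and> J \<subseteq> {1..} \<and> I \<inter> J = {} \<and>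
        l1_lipschitz I f \<and> l1_lipschitz J g \<longrightarrow>
        (let Y = (\<lambda>\<omega>. f (\<lambda>i\<in>I. X i \<omega>)); Z = (\<lambda>\<omega>. g (\<lambda>j\<in>J. X j \<omega>)) in
          cov_defined M Y Z \<and>
          \<bar>cov M Y Z\<bar> \<le> lip_norm I f * lip_norm J g *
             (\<Sum>i\<in>I. \<Sum>j\<in>J. \<gamma> (nat \<bar>int j - int i\<bar>))))"

definition strictly_stationary :: "'a measure \<Rightarrow> (nat \<Rightarrow> 'a \<Rightarrow> real) \<Rightarrow> bool" where
  "strictly_stationary M X \<longleftrightarrow>
     (\<forall>h I. finite I \<and> I \<subseteq> {1..} \<longrightarrow>
        distr M (Pi\<^sub>M I (\<lambda>_. borel)) (\<lambda>\<omega>. \<lambda>i\<in>I. X (i + h) \<omega>) =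
        distr M (Pi\<^sub>M I (\<lambda>_. borel)) (\<lambda>\<omega>. \<lambda>i\<in>I. X i \<omega>))"

definition partial_sum :: "(nat \<Rightarrow> 'a \<Rightarrow> real) \<Rightarrow> nat \<Rightarrow> 'a \<Rightarrow> real" where
  "partial_sum X n \<omega> = (\<Sum>i=1..n. X i \<omega>)"

end

theory Submission
  imports Defs "HOL-Real_Asymp.Real_Asymp"
begin

text \<open>
  By stationarity, \<open>E S\<^sub>n\<^sup>2 = O(n)\<close> bounds the second moment of the increment of \<open>S\<close> over any
  dyadic interval by a multiple of its length. If \<open>b\<close> bounds
  all dyadic increments inside \<open>[0, 2\<^sup>m]\<close>, then writing \<open>k < 2\<^sup>m\<close> in binary gives \<open>|S\<^sub>k| \<le> m b\<close>.
  For \<open>b = 2 powr (m a)\<close> with \<open>a > 1/2\<close>, Chebyshev's inequality and a union bound make the exceptional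
  probabilities \<open>O(m 2 powr (m (1 - 2 a)))\<close>, which are summable, so Borel--Cantelli yields
  \<open>S\<^sub>n = O(n powr a log n)\<close> almost surely.
\<close>

text \<open>Clear the binary digits of \<open>k\<close> from the lowest up: a digit 1 at position
  \<open>j\<close> costs one dyadic increment of length \<open>2 ^ j\<close>, a digit 0 costs
  nothing, and after \<open>m\<close> digits only \<open>s 0\<close> is left.\<close>

lemma dyadic_chaining:
  fixes s :: "nat \<Rightarrow> real"
  assumes s0: "s 0 = 0"
    and b: "\<And>j i. j < m \<Longrightarrow> i < 2 ^ (m - j) \<Longrightarrow> \<bar>s (i * 2 ^ j + 2 ^ j) - s (i * 2 ^ j)\<bar> \<le> b"
    and k: "k < 2 ^ m"
  shows "\<bar>s k\<bar> \<le> real m * b"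
proof -
  \<comment> \<open>\<open>k div 2 ^ j * 2 ^ j\<close> is \<open>k\<close> with its \<open>j\<close>
    lowest binary digits set to 0.\<close>
  have "j \<le> m \<Longrightarrow> \<bar>s k - s (k div 2 ^ j * 2 ^ j)\<bar> \<le> real j * b" for j
  proof (induction j)
    case 0
    then show ?case by simp
  next
    case (Suc j)
    define p where "p = k div 2 ^ Suc j"
    have p: "k div 2 ^ j div 2 = p"
      unfolding p_def power_Suc2 by (simp only: div_mult2_eq)
    have p_eq: "p * 2 ^ Suc j = 2 * p * 2 ^ j" by simp
    have step: "\<bar>s (k div 2 ^ j * 2 ^ j) - s (2 * p * 2 ^ j)\<bar> \<le> b"
    proof (cases "even (k div 2 ^ j)")
      case True
      \<comment> \<open>The digit is 0, so the difference vanishes. The bound at block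
        \<open>i = 0\<close> shows that \<open>b\<close> dominates an absolute value.\<close>
      have "b \<ge> 0" using b[of j 0] Suc.prems by (smt (verit) Suc_le_lessD zero_less_power zero_less_numeral)
      with True p show ?thesis by auto
    next
      case False
      with p have eq: "k div 2 ^ j = 2 * p + 1" by (metis odd_two_times_div_two_succ)
      have "k div 2 ^ j < 2 ^ (m - j)"
        using k Suc.prems by (simp add: less_mult_imp_div_less flip: power_add)
      then have "\<bar>s (2 * p * 2 ^ j + 2 ^ j) - s (2 * p * 2 ^ j)\<bar> \<le> b"
        using eq Suc.prems by (intro b) auto
      then show ?thesis unfolding eq by (simp add: algebra_simps)
    qed
    have "\<bar>s k - s (k div 2 ^ j * 2 ^ j)\<bar> \<le> real j * b" using Suc by simp
    with step have "\<bar>s k - s (p * 2 ^ Suc j)\<bar> \<le> real j * b + b" unfolding p_eq by linarith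
    then show ?case by (simp add: p_def algebra_simps)
  qed
  from this[of m] show ?thesis using k s0 by simp
qed

text \<open>At scale \<open>m\<close> there are \<open>2 ^ (m - j)\<close> blocks of length
  \<open>2 ^ j\<close>, each with second moment at most \<open>C * 2 ^ j\<close>. Every level
  \<open>j\<close> therefore contributes the same amount to the union bound, and the
  \<open>m\<close> levels cost only a factor \<open>m\<close>.\<close>

lemma (in prob_space) AE_bigo_of_second_moment_increments:
  fixes S :: "nat \<Rightarrow> 'a \<Rightarrow> real"
  assumes meas [measurable]: "\<And>n. S n \<in> borel_measurable M"
    and S0: "\<And>\<omega>. S 0 \<omega> = 0"
    and int: "\<And>h n. integrable M (\<lambda>\<omega>. (S (h + n) \<omega> - S h \<omega>)\<^sup>2)"
    and C: "\<And>h n. expectation (\<lambda>\<omega>. (S (h + n) \<omega> - S h \<omega>)\<^sup>2) \<le> C * real n"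
    and a: "a > 1 / 2"
  shows "AE \<omega> in M. (\<lambda>n. S n \<omega>) \<in> O(\<lambda>n. ln (real n) * real n powr a)"
proof -
  \<comment> \<open>The threshold \<open>q ^ m\<close> equals \<open>(2 ^ m) powr a\<close>; as a
    natural power it makes the bounds geometric in \<open>m\<close>.\<close>
  define q :: real where "q = 2 powr a"
  define D where "D j i \<omega> = S (i * 2 ^ j + 2 ^ j) \<omega> - S (i * 2 ^ j) \<omega>" for i j \<omega>
  define B where "B m j i = {\<omega> \<in> space M. \<bar>D j i \<omega>\<bar> \<ge> q ^ m}" for m j i :: nat
  define A where "A m = (\<Union>j<m. \<Union>i<2 ^ (m - j). B m j i)" for m :: nat
  have q: "q > 0" by (simp add: q_def)
  \<comment> \<open>Here \<open>a > 1 / 2\<close> enters: it makes the ratio of the geometric bound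
    less than 1.\<close>
  have "q\<^sup>2 = 2 powr (2 * a)" by (simp add: q_def powr_power mult.commute)
  moreover have "(2::real) powr 1 < 2 powr (2 * a)" using a by (intro powr_less_mono) auto
  ultimately have r: "2 / q\<^sup>2 < 1" by simp
  have D_meas [measurable]: "D j i \<in> borel_measurable M" for i j
    unfolding D_def by measurable
  have B_meas [measurable]: "B m j i \<in> sets M" for m i j
    unfolding B_def by measurable
  have A_meas: "A m \<in> sets M" for m
    unfolding A_def by measurable
  have B_le: "prob (B m j i) \<le> C * 2 ^ j / (q ^ m)\<^sup>2" for m j i
  proof -
    have "prob (B m j i) \<le> expectation (\<lambda>\<omega>. (D j i \<omega>)\<^sup>2) / (q ^ m)\<^sup>2"
      unfolding B_def using q int by (intro second_moment_method) (auto simp: D_def)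
    also have "\<dots> \<le> C * 2 ^ j / (q ^ m)\<^sup>2"
      using C[of "i * 2 ^ j" "2 ^ j"] by (intro divide_right_mono) (auto simp: D_def)
    finally show ?thesis .
  qed
  have A_le: "prob (A m) \<le> C * (real m * (2 / q\<^sup>2) ^ m)" for m
  proof -
    have "prob (A m) \<le> (\<Sum>j<m. prob (\<Union>i<2 ^ (m - j). B m j i))"
      unfolding A_def by (intro finite_measure_subadditive_finite) auto
    also have "\<dots> \<le> (\<Sum>j<m. \<Sum>i<2 ^ (m - j). prob (B m j i))"
      by (intro sum_mono finite_measure_subadditive_finite) auto
    also have "\<dots> \<le> (\<Sum>j<m. \<Sum>i<(2::nat) ^ (m - j). C * 2 ^ j / (q ^ m)\<^sup>2)"
      by (intro sum_mono B_le)
    also have "\<dots> = (\<Sum>j<m. C * 2 ^ m / (q ^ m)\<^sup>2)"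
    proof (intro sum.cong refl)
      fix j assume "j \<in> {..<m}"
      then have "(2::real) ^ m = 2 ^ (m - j) * 2 ^ j" by (simp flip: power_add)
      then show "(\<Sum>i<(2::nat) ^ (m - j). C * 2 ^ j / (q ^ m)\<^sup>2) = C * 2 ^ m / (q ^ m)\<^sup>2"
        by simp
    qed
    also have "\<dots> = C * (real m * (2 / q\<^sup>2) ^ m)"
      by (simp add: power_divide power_mult[symmetric] mult.commute)
    finally show ?thesis .
  qed
  \<comment> \<open>The derivative of the geometric series absorbs the factor \<open>m\<close> from
    the number of levels.\<close>
  have "summable (\<lambda>m. real (Suc m) * (2 / q\<^sup>2) ^ m)"
    using geometric_deriv_sums[of "2 / q\<^sup>2"] r by (auto simp: sums_iff)
  then have "summable (\<lambda>m. real m * (2 / q\<^sup>2) ^ m)"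
    by (rule summable_comparison_test') (auto intro!: mult_right_mono)
  then have "summable (\<lambda>m. C * (real m * (2 / q\<^sup>2) ^ m))" by (rule summable_mult)
  then have "summable (\<lambda>m. prob (A m))"
    by (rule summable_comparison_test') (use A_le in auto)
  then have "AE \<omega> in M. eventually (\<lambda>m. \<omega> \<in> space M - A m) sequentially"
    by (intro borel_cantelli_AE1 A_meas) (auto simp: emeasure_eq_measure)
  then show ?thesis
  proof (rule AE_mp, intro AE_I2 impI)
    fix \<omega> assume \<omega>: "\<omega> \<in> space M" and ev: "eventually (\<lambda>m. \<omega> \<in> space M - A m) sequentially"
    then obtain N where N: "\<And>m. m \<ge> N \<Longrightarrow> \<omega> \<notin> A m"
      unfolding eventually_sequentially by blast
    show "(\<lambda>n. S n \<omega>) \<in> O(\<lambda>n. ln (real n) * real n powr a)"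
    \<comment> \<open>The term \<open>2 ^ N\<close> forces \<open>p + 1 \<ge> N\<close> below, and 3
      ensures \<open>ln n \<ge> 1\<close>. In the constant, 3 comes from
      \<open>p + 1 \<le> 3 * ln n\<close>, and \<open>q\<close> from passing from
      \<open>q ^ p\<close> to \<open>q ^ (p + 1)\<close>.\<close>
    proof (rule bigoI[of _ "3 * q"], rule eventually_sequentiallyI[of "2 ^ N + 3"])
      fix n :: nat assume n: "n \<ge> 2 ^ N + 3"
      then obtain p where p: "2 ^ p \<le> n" "n < 2 ^ (p + 1)"
        using ex_power_ivl1[of 2 n] by auto
      have "(2::nat) ^ N < 2 ^ (p + 1)" using n p by linarith
      then have "N < p + 1" by (rule power_less_imp_less_exp[rotated]) simp
      then have "p + 1 \<ge> N" by simp
      then have notA: "\<omega> \<notin> A (p + 1)" by (rule N)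
      have S_le: "\<bar>S n \<omega>\<bar> \<le> real (p + 1) * q ^ (p + 1)"
      proof (rule dyadic_chaining[of "\<lambda>n. S n \<omega>"])
        fix j i :: nat assume "j < p + 1" "i < 2 ^ (p + 1 - j)"
        with notA have "\<omega> \<notin> B (p + 1) j i" unfolding A_def by blast
        with \<omega> show "\<bar>S (i * 2 ^ j + 2 ^ j) \<omega> - S (i * 2 ^ j) \<omega>\<bar> \<le> q ^ (p + 1)"
          by (simp add: B_def D_def)
      qed (use S0 p in auto)
      have two_p: "(2::real) ^ p \<le> real n"
        using p(1) by (metis of_nat_le_iff of_nat_numeral of_nat_power)
      have "exp 1 \<le> real n" using exp_le n by linarith
      then have ln_n: "ln (real n) \<ge> 1" using n by (subst ln_ge_iff) auto
      have "real p * ln 2 = ln ((2::real) ^ p)" by (simp add: ln_realpow)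
      also have "\<dots> \<le> ln (real n)" using two_p n by simp
      finally have "real p * ln 2 \<le> ln (real n)" .
      moreover have "real p * (1 / 2) \<le> real p * ln 2"
        using ln2_ge_two_thirds by (intro mult_left_mono) auto
      ultimately have p_le: "real (p + 1) \<le> 3 * ln (real n)" using ln_n by simp
      have "q ^ p = (2 ^ p) powr a"
        by (simp add: q_def powr_powr mult.commute flip: powr_realpow)
      also have "\<dots> \<le> real n powr a" using two_p a by (intro powr_mono2) auto
      finally have "q ^ (p + 1) \<le> q * real n powr a" using q by simp
      then have "real (p + 1) * q ^ (p + 1) \<le> (3 * ln (real n)) * (q * real n powr a)"
        using p_le q by (intro mult_mono) auto
      with S_le show "norm (S n \<omega>) \<le> 3 * q * norm (ln (real n) * real n powr a)"
        using ln_n by (simp add: abs_mult mult_ac)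
    qed
  qed
qed

text \<open>Induction on the index set, dominating by means of
  \<open>(u + v)\<^sup>2 \<le> 2 * (u\<^sup>2 + v\<^sup>2)\<close>.\<close>

lemma integrable_sum_square:
  fixes f :: "'i \<Rightarrow> 'a \<Rightarrow> real"
  assumes "finite I" "\<And>i. i \<in> I \<Longrightarrow> f i \<in> borel_measurable M"
    and "\<And>i. i \<in> I \<Longrightarrow> integrable M (\<lambda>x. (f i x)\<^sup>2)"
  shows "integrable M (\<lambda>x. (\<Sum>i\<in>I. f i x)\<^sup>2)"
  using assms
proof (induction I rule: finite_induct)
  case empty
  then show ?case by simp
next
  case (insert i I)
  have [measurable]: "f j \<in> borel_measurable M" if "j \<in> insert i I" for j
    using insert.prems that by blast
  have "integrable M (\<lambda>x. 2 * ((f i x)\<^sup>2 + (\<Sum>i\<in>I. f i x)\<^sup>2))"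
    using insert by auto
  then have "integrable M (\<lambda>x. (f i x + (\<Sum>i\<in>I. f i x))\<^sup>2)"
  proof (rule Bochner_Integration.integrable_bound)
    show "(\<lambda>x. (f i x + (\<Sum>i\<in>I. f i x))\<^sup>2) \<in> borel_measurable M" by measurable
    show "AE x in M. norm ((f i x + (\<Sum>i\<in>I. f i x))\<^sup>2)
        \<le> norm (2 * ((f i x)\<^sup>2 + (\<Sum>i\<in>I. f i x)\<^sup>2))"
    proof (rule AE_I2)
      fix x
      have "(u + v)\<^sup>2 \<le> 2 * (u\<^sup>2 + v\<^sup>2)" for u v :: real
        using zero_le_power2[of "u - v"] by (simp add: power2_eq_square algebra_simps)
      then show "norm ((f i x + (\<Sum>i\<in>I. f i x))\<^sup>2) \<le> norm (2 * ((f i x)\<^sup>2 + (\<Sum>i\<in>I. f i x)\<^sup>2))"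
        by simp
    qed
  qed
  then show ?case using insert.hyps by simp
qed

text \<open>Both sides are integrals of \<open>F\<close> against laws on the coordinate space over
  \<open>I\<close>, and stationarity identifies these laws. The unshifted side is treated as the
  shift \<open>h = 0\<close>.\<close>

lemma
  fixes X :: "nat \<Rightarrow> 'a \<Rightarrow> real" and F :: "(nat \<Rightarrow> real) \<Rightarrow> real"
  assumes "strictly_stationary M X"
    and X: "\<And>n. n \<ge> 1 \<Longrightarrow> X n \<in> borel_measurable M"
    and I: "finite I" "I \<subseteq> {1..}"
    and F: "F \<in> borel_measurable (Pi\<^sub>M I (\<lambda>_. borel))"
  shows strictly_stationary_integrable_iff:
      "integrable M (\<lambda>\<omega>. F (\<lambda>i\<in>I. X (i + h) \<omega>)) \<longleftrightarrow> integrable M (\<lambda>\<omega>. F (\<lambda>i\<in>I. X i \<omega>))"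
    and strictly_stationary_integral_eq:
      "(LINT \<omega>|M. F (\<lambda>i\<in>I. X (i + h) \<omega>)) = (LINT \<omega>|M. F (\<lambda>i\<in>I. X i \<omega>))"
proof -
  have meas: "(\<lambda>\<omega>. \<lambda>i\<in>I. X (i + h) \<omega>) \<in> measurable M (Pi\<^sub>M I (\<lambda>_. borel))" for h
    using I by (intro measurable_restrict X) auto
  have eq: "distr M (Pi\<^sub>M I (\<lambda>_. borel)) (\<lambda>\<omega>. \<lambda>i\<in>I. X (i + h) \<omega>) =
      distr M (Pi\<^sub>M I (\<lambda>_. borel)) (\<lambda>\<omega>. \<lambda>i\<in>I. X i \<omega>)"
    using assms unfolding strictly_stationary_def by blast
  show "integrable M (\<lambda>\<omega>. F (\<lambda>i\<in>I. X (i + h) \<omega>)) \<longleftrightarrow> integrable M (\<lambda>\<omega>. F (\<lambda>i\<in>I. X i \<omega>))"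
    using integrable_distr_eq[OF meas F, of h] integrable_distr_eq[OF meas F, of 0] eq by simp
  show "(LINT \<omega>|M. F (\<lambda>i\<in>I. X (i + h) \<omega>)) = (LINT \<omega>|M. F (\<lambda>i\<in>I. X i \<omega>))"
    using integral_distr[OF meas F, of h] integral_distr[OF meas F, of 0] eq by simp
qed

text \<open>Puts increments into the shifted form to which stationarity applies.\<close>

lemma partial_sum_diff:
  "partial_sum X (h + n) \<omega> - partial_sum X h \<omega> = (\<Sum>i=1..n. X (i + h) \<omega>)"
  by (induction n) (simp_all add: partial_sum_def add.commute)

text \<open>The quadratic Taylor polynomial of \<open>exp\<close> at \<open>\<bar>y\<bar>\<close>
  gives the domination \<open>y\<^sup>2 \<le> 2 * exp \<bar>y\<bar>\<close>.\<close>

lemma integrable_square_of_exp_abs: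
  fixes Y :: "'a \<Rightarrow> real"
  assumes [measurable]: "Y \<in> borel_measurable M"
    and fin: "(\<integral>\<^sup>+ \<omega>. ennreal (exp \<bar>Y \<omega>\<bar>) \<partial>M) < \<infinity>"
  shows "integrable M (\<lambda>\<omega>. (Y \<omega>)\<^sup>2)"
proof (rule Bochner_Integration.integrable_bound)
  show "integrable M (\<lambda>\<omega>. 2 * exp \<bar>Y \<omega>\<bar>)"
    using fin by (intro integrable_mult_right integrableI_bounded) auto
  have "y\<^sup>2 \<le> 2 * exp \<bar>y\<bar>" for y :: real
    using exp_lower_Taylor_quadratic[of "\<bar>y\<bar>"] by simp
  then show "AE \<omega> in M. norm ((Y \<omega>)\<^sup>2) \<le> norm (2 * exp \<bar>Y \<omega>\<bar>)"
    by simp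
qed measurable

theorem theorem13:
  fixes M :: "'a measure" and X :: "nat \<Rightarrow> 'a \<Rightarrow> real" and \<gamma> :: "nat \<Rightarrow> real"
    and sigma2 \<rho> \<tau> U :: real
  assumes "prob_space M"
    and "\<And>n. n \<ge> 1 \<Longrightarrow> X n \<in> borel_measurable M"
    and "strictly_stationary M X"
    and "\<And>n. n \<ge> 1 \<Longrightarrow> integrable M (X n) \<and> (LINT \<omega>|M. X n \<omega>) = 0"
    and "L_weakly_dependent M X \<gamma>"
    and "sigma2 > 0"
    and "(\<lambda>n. (1 / real n) * (LINT \<omega>|M. (partial_sum X n \<omega>)\<^sup>2)) \<longlonglongrightarrow> sigma2"
    and "0 < \<rho>" and "\<rho> < 1"
    and "(\<lambda>n. \<Sum>k. \<gamma> (n + k)) \<in> O(\<lambda>n. \<rho> ^ n)"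
    and "\<tau> > 3" and "U > 0"
    and "(SUP t\<in>{t. \<bar>t\<bar> \<le> \<tau>}. \<integral>\<^sup>+ \<omega>. ennreal (exp (t * \<bar>X 1 \<omega>\<bar>)) \<partial>M) \<le> ennreal U"
  shows "(AE \<omega> in M. (\<lambda>n. (1 / real n) * partial_sum X n \<omega>) \<longlonglongrightarrow> 0) \<and>
         (\<forall>\<delta>>0. AE \<omega> in M. (\<lambda>n. (1 / real n) * partial_sum X n \<omega>)
            \<in> O(\<lambda>n. ln (real n) powr (3 / 2) / real n powr (1 / 2 - \<delta>)))"
proof -
  interpret prob_space M by fact
  note X = assms(2) and stat = assms(3)
  \<comment> \<open>The exponent \<open>t = 1\<close> is admissible since
    \<open>\<tau> > 3\<close>.\<close>
  have "(\<integral>\<^sup>+ \<omega>. ennreal (exp (1 * \<bar>X 1 \<omega>\<bar>)) \<partial>M) \<le> ennreal U"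
    using \<open>\<tau> > 3\<close> by (intro order_trans[OF SUP_upper assms(13)]) auto
  also have "\<dots> < \<infinity>" by simp
  finally have X1: "integrable M (\<lambda>\<omega>. (X 1 \<omega>)\<^sup>2)"
    using X by (intro integrable_square_of_exp_abs) auto
  have Xi: "integrable M (\<lambda>\<omega>. (X i \<omega>)\<^sup>2)" if "i \<ge> 1" for i
    using strictly_stationary_integrable_iff[OF stat X, of "{1}" "\<lambda>x. (x 1)\<^sup>2" "i - 1"] X1 that
    by simp
  define S where "S = partial_sum X"
  have S_0: "S 0 \<omega> = 0" for \<omega>
    by (simp add: S_def partial_sum_def)
  have S_meas: "S n \<in> borel_measurable M" for n
    unfolding S_def partial_sum_def using X by (intro borel_measurable_sum) auto
  have S_int: "integrable M (\<lambda>\<omega>. (S (h + n) \<omega> - S h \<omega>)\<^sup>2)" for h n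
    unfolding S_def partial_sum_diff using X Xi by (intro integrable_sum_square) auto
  \<comment> \<open>By stationarity the second moment of an increment depends only on its
    length.\<close>
  have S_eq: "expectation (\<lambda>\<omega>. (S (h + n) \<omega> - S h \<omega>)\<^sup>2) = expectation (\<lambda>\<omega>. (S n \<omega>)\<^sup>2)" for h n
  proof -
    have "(\<lambda>x. (\<Sum>i=1..n. x i)\<^sup>2) \<in> borel_measurable (Pi\<^sub>M {1..n} (\<lambda>_. borel :: real measure))"
      by measurable
    from strictly_stationary_integral_eq[OF stat X _ _ this, of h] show ?thesis
      unfolding S_def partial_sum_diff by (simp add: partial_sum_def)
  qed
  \<comment> \<open>Convergence of the normalised variances supplies the constant \<open>C\<close>
    of the linear bound.\<close>
  have "Bseq (\<lambda>n. (1 / real n) * expectation (\<lambda>\<omega>. (S n \<omega>)\<^sup>2))"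
    using assms(7) unfolding S_def by (intro convergent_imp_Bseq convergentI)
  then obtain C where C: "\<And>n. \<bar>(1 / real n) * expectation (\<lambda>\<omega>. (S n \<omega>)\<^sup>2)\<bar> \<le> C"
    by (auto simp: Bseq_def)
  have S_le: "expectation (\<lambda>\<omega>. (S n \<omega>)\<^sup>2) \<le> C * real n" for n
  \<comment> \<open>Since \<open>1 / real 0 = 0\<close>, the bound on the ratio says nothing at
    \<open>n = 0\<close>; there \<open>S 0 = 0\<close> is used.\<close>
  proof (cases "n = 0")
    case True
    then show ?thesis by (simp add: S_0)
  next
    case False
    then show ?thesis using C[of n] by (simp add: field_simps)
  qed
  have main: "AE \<omega> in M. (\<lambda>n. (1 / real n) * S n \<omega>) \<in>
      O(\<lambda>n. ln (real n) powr (3 / 2) / real n powr (1 / 2 - \<delta>))" if "\<delta> > 0" for \<delta>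
  proof -
    have "AE \<omega> in M. (\<lambda>n. S n \<omega>) \<in> O(\<lambda>n. ln (real n) * real n powr (1 / 2 + \<delta>))"
      using S_meas S_0 S_int S_eq S_le that
      by (intro AE_bigo_of_second_moment_increments[where C = C]) auto
    then show ?thesis
    proof (rule AE_mp, intro AE_I2 impI)
      fix \<omega> assume "(\<lambda>n. S n \<omega>) \<in> O(\<lambda>n. ln (real n) * real n powr (1 / 2 + \<delta>))"
      then have "(\<lambda>n. (1 / real n) * S n \<omega>) \<in>
          O(\<lambda>n. (1 / real n) * (ln (real n) * real n powr (1 / 2 + \<delta>)))"
        by (intro landau_o.big.mult_left)
      \<comment> \<open>The powers of \<open>n\<close> agree on both sides, and
        \<open>ln n \<le> ln n powr (3 / 2)\<close> once \<open>ln n \<ge> 1\<close>.\<close>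
      also have "(\<lambda>n. (1 / real n) * (ln (real n) * real n powr (1 / 2 + \<delta>))) \<in>
          O(\<lambda>n. ln (real n) powr (3 / 2) / real n powr (1 / 2 - \<delta>))"
        by real_asymp
      finally show "(\<lambda>n. (1 / real n) * S n \<omega>) \<in>
          O(\<lambda>n. ln (real n) powr (3 / 2) / real n powr (1 / 2 - \<delta>))" .
    qed
  qed
  have "AE \<omega> in M. (\<lambda>n. (1 / real n) * S n \<omega>) \<longlonglongrightarrow> 0"
  \<comment> \<open>Any positive \<open>\<delta> < 1 / 2\<close> would do: the power of
    \<open>n\<close> in the denominator then beats the logarithm.\<close>
  proof (rule AE_mp[OF main[of "1 / 4"]], simp, intro AE_I2 impI)
    fix \<omega>
    assume "(\<lambda>n. (1 / real n) * S n \<omega>) \<in>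
        O(\<lambda>n. ln (real n) powr (3 / 2) / real n powr (1 / 2 - 1 / 4))"
    also have "(\<lambda>n. ln (real n) powr (3 / 2) / real n powr (1 / 2 - 1 / 4)) \<in> o(\<lambda>_. 1 :: real)"
      by real_asymp
    finally show "(\<lambda>n. (1 / real n) * S n \<omega>) \<longlonglongrightarrow> 0"
      by (auto dest: smalloD_tendsto)
  qed
  with main show ?thesis unfolding S_def by blast
qed

end
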